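(* Let $f:\mathbb{C}\to\mathbb{C}$ be a transcendental entire function. Then its Julia set is nonempty: $\mathcal{J}_f\neq\emptyset$.
   Context: A transcendental entire function is an entire function $\mathbb{C}\to\mathbb{C}$ that is not a polynomial. For $n\ge 1$, $f^{\circ n}$ denotes the $n$-th iterate of $f$ (so $f^{\circ 2}=f\circ f$). The Fatou set $\mathcal{F}_f\subset\mathbb{C}$ of $f$ is the set of points of $\mathbb{C}$ having a neighbourhood on which the iterates $\{f^{\circ n}\}_{n\ge 1}$ form a normal family of holomorphic functions. Normality is in the usual sense of Montel: every sequence in the family has a subsequence converging uniformly on compact subsets with respect to the spherical metric, the limit being allowed to be identically $\infty$. The Julia set is the complement $\mathcal{J}_f:=\mathbb{C}\setminus\mathcal{F}_f$. *)

theory Defs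
  imports "HOL-Complex_Analysis.Complex_Analysis" "HOL-Computational_Algebra.Polynomial"
begin

definition transcendental_entire :: "(complex \<Rightarrow> complex) \<Rightarrow> bool" where
  "transcendental_entire f \<longleftrightarrow> f holomorphic_on UNIV \<and> (\<nexists>p. f = poly p)"

(* The Riemann sphere is represented by complex option, with None for the point at infinity.
   The stereographic projection maps it onto the unit sphere of the Euclidean space
   complex * real, sending infinity to the north pole. *)
fun stereographic :: "complex option \<Rightarrow> complex \<times> real" where
  "stereographic None = (0, 1)"
| "stereographic (Some z) =
     ((2 / ((cmod z)\<^sup>2 + 1)) *\<^sub>R z, ((cmod z)\<^sup>2 - 1) / ((cmod z)\<^sup>2 + 1))"

lemma norm_stereographic: "norm (stereographic p) = 1"
proof (cases p)
  case None
  then show ?thesis by (simp add: norm_Pair)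
next
  case (Some z)
  define t where "t = (cmod z)\<^sup>2"
  have t: "t + 1 > 0" unfolding t_def by (simp add: add_nonneg_pos)
  have "(norm (stereographic p))\<^sup>2 = (2 / (t + 1))\<^sup>2 * t + ((t - 1) / (t + 1))\<^sup>2"
    using Some by (simp add: norm_Pair t_def power_mult_distrib power_divide)
  also have "\<dots> = (4 * t + (t - 1)\<^sup>2) / (t + 1)\<^sup>2"
    by (simp add: power_divide add_divide_distrib)
  also have "4 * t + (t - 1)\<^sup>2 = (t + 1)\<^sup>2"
    by (simp add: power2_eq_square algebra_simps)
  finally have "(norm (stereographic p))\<^sup>2 = 1" using t by simp
  then show ?thesis by (simp add: power2_eq_1_iff) (smt (verit) norm_ge_zero)
qed

(* Great-circle distance: the angle between the two corresponding unit vectors. *)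
definition spherical_dist :: "complex option \<Rightarrow> complex option \<Rightarrow> real" where
  "spherical_dist p q = arccos (stereographic p \<bullet> stereographic q)"

(* The limit g takes values in the sphere; it may be identically infinity (g = (\<lambda>_. None)). *)
definition spherical_uniform_limit ::
  "complex set \<Rightarrow> (nat \<Rightarrow> complex \<Rightarrow> complex) \<Rightarrow> (complex \<Rightarrow> complex option) \<Rightarrow> bool" where
  "spherical_uniform_limit K h g \<longleftrightarrow>
     (\<forall>e>0. \<exists>N. \<forall>n\<ge>N. \<forall>z\<in>K. spherical_dist (Some (h n z)) (g z) < e)"

definition normal_family_on :: "complex set \<Rightarrow> (complex \<Rightarrow> complex) set \<Rightarrow> bool" where
  "normal_family_on U F \<longleftrightarrow>
     (\<forall>h\<in>F. h holomorphic_on U) \<and>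
     (\<forall>h :: nat \<Rightarrow> complex \<Rightarrow> complex. range h \<subseteq> F \<longrightarrow>
        (\<exists>r g. strict_mono (r :: nat \<Rightarrow> nat) \<and>
           (\<forall>K. compact K \<and> K \<subseteq> U \<longrightarrow> spherical_uniform_limit K (h \<circ> r) g)))"

definition Fatou_set :: "(complex \<Rightarrow> complex) \<Rightarrow> complex set" where
  "Fatou_set f = {z. \<exists>U. open U \<and> z \<in> U \<and> normal_family_on U {f ^^ n |n. n \<ge> 1}}"

definition Julia_set :: "(complex \<Rightarrow> complex) \<Rightarrow> complex set" where
  "Julia_set f = - Fatou_set f"

end

theory Submission
  imports Defs
begin

text \<open>
  Suppose the Julia set is empty. By Picard's theorem \<open>f \<circ> f\<close> has a fixed point, whose orbit under
  \<open>f\<close> is bounded. By normality and Hurwitz' theorem, bounded orbits propagate: the set of points with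
  bounded orbit is open and closed, hence the whole plane, and the iterates are uniformly bounded on
  compact sets. On the other hand, by Schottky's theorem and the superlinear growth of \<open>f\<close>, the image
  of every large disc of radius \<open>r\<close> about \<open>0\<close> contains a circle about \<open>0\<close> of radius at least \<open>2r\<close>.
  With the maximum modulus principle it follows that \<open>f^n\<close> attains modulus at least \<open>2^n r\<close> on that
  disc, a contradiction.
\<close>

section \<open>Spherical convergence in stereographic coordinates\<close>

text \<open>A chord is no longer than its arc: unit vectors at angle \<open>t\<close> are
  \<open>2 * sin (t/2)\<close> apart.\<close>

lemma dist_stereographic_le_spherical_dist:
  "dist (stereographic p) (stereographic q) \<le> spherical_dist p q"
proof -
  define a b where "a = stereographic p" and "b = stereographic q"
  define t where "t = spherical_dist p q"
  have na: "norm a = 1" "norm b = 1"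
    by (simp_all add: a_def b_def norm_stereographic)
  have "\<bar>a \<bullet> b\<bar> \<le> 1"
    using Cauchy_Schwarz_ineq2[of a b] na by simp
  hence ab: "cos t = a \<bullet> b" and t0: "t \<ge> 0"
    unfolding t_def spherical_dist_def a_def b_def by (auto simp: cos_arccos_abs arccos_lbound)
  have "(dist a b)\<^sup>2 = a \<bullet> a + b \<bullet> b - 2 * (a \<bullet> b)"
    by (simp add: dist_norm power2_norm_eq_inner inner_diff inner_commute)
  also have "\<dots> = 2 - 2 * cos t"
    using na by (simp add: ab flip: power2_norm_eq_inner)
  also have "\<dots> = (2 * sin (t/2))\<^sup>2"
    using cos_double_sin[of "t/2"] by (simp add: power_mult_distrib)
  also have "\<dots> = (2 * \<bar>sin (t/2)\<bar>)\<^sup>2"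
    by (simp add: power_mult_distrib)
  also have "\<dots> \<le> t\<^sup>2"
    using abs_sin_x_le_abs_x[of "t/2"] t0 by (intro power_mono) auto
  finally show ?thesis
    using t0 unfolding t_def a_def b_def by (rule power2_le_imp_le)
qed

text \<open>Passing to chordal distance makes the theory of \<open>uniform_limit\<close> applicable;
  all later arguments use spherical convergence through this lemma.\<close>

lemma spherical_uniform_limit_stereographic:
  assumes "spherical_uniform_limit K h g"
  shows "uniform_limit K (\<lambda>n z. stereographic (Some (h n z))) (\<lambda>z. stereographic (g z)) sequentially"
proof (rule uniform_limitI)
  fix e :: real assume "e > 0"
  then obtain N where "\<forall>n\<ge>N. \<forall>z\<in>K. spherical_dist (Some (h n z)) (g z) < e"
    using assms unfolding spherical_uniform_limit_def by blast
  thus "\<forall>\<^sub>F n in sequentially. \<forall>z\<in>K. dist (stereographic (Some (h n z))) (stereographic (g z)) < e"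
    unfolding eventually_sequentially
    by (meson dist_stereographic_le_spherical_dist le_less_trans)
qed

lemma continuous_on_stereographic_Some:
  assumes "continuous_on A f"
  shows "continuous_on A (\<lambda>z. stereographic (Some (f z)))"
proof -
  have "(cmod z)\<^sup>2 + 1 \<noteq> 0" for z
    by (smt (verit) zero_le_power2)
  thus ?thesis
    using assms by (auto intro!: continuous_intros)
qed

text \<open>The height on the sphere increases with the modulus, so a bound on the modulus amounts
  to a bound on the height below 1, the height of infinity.\<close>

lemma snd_stereographic_Some:
  "snd (stereographic (Some z)) = 1 - 2 / ((cmod z)\<^sup>2 + 1)"
proof -
  have "(cmod z)\<^sup>2 + 1 > 0"
    by (smt (verit) zero_le_power2)
  thus ?thesis
    by (simp add: field_simps)
qed

lemma snd_stereographic_eq_1_iff: "snd (stereographic p) = 1 \<longleftrightarrow> p = None"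
proof (cases p)
  case (Some z)
  have "(cmod z)\<^sup>2 + 1 > 0"
    by (smt (verit) zero_le_power2)
  thus ?thesis
    by (simp add: Some snd_stereographic_Some del: stereographic.simps)
qed auto

text \<open>In the chart at infinity the sphere point \<open>z\<close> has coordinate \<open>1 / z\<close>.\<close>

lemma stereographic_inverse:
  "cnj (fst (stereographic (Some z))) / of_real (1 + snd (stereographic (Some z))) = inverse z"
proof (cases "z = 0")
  case False
  define s where "s = (cmod z)\<^sup>2"
  have s: "s > 0" "s + 1 > 0" using False by (auto simp: s_def add_pos_pos)
  have zz: "z * cnj z = of_real s"
    unfolding s_def by (rule complex_norm_square[symmetric])
  have "1 + (s - 1) / (s + 1) = 2 * s / (s + 1)"
    using s by (simp add: field_simps)
  hence "cnj (fst (stereographic (Some z))) / of_real (1 + snd (stereographic (Some z)))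
      = (2 / (s + 1)) *\<^sub>R cnj z / of_real (2 * s / (s + 1))"
    by (simp add: s_def)
  also have "\<dots> = cnj z / of_real s"
    using s by (simp add: scaleR_conv_of_real field_simps flip: of_real_add)
  also have "\<dots> = inverse z"
    using False s by (simp add: field_simps flip: zz)
  finally show ?thesis .
qed auto

section \<open>Limits of holomorphic functions and bounds for normal families\<close>

lemma spherical_limit_continuous_on:
  assumes U: "open U" and h: "\<And>n. h n holomorphic_on U"
    and lim: "\<And>K. compact K \<Longrightarrow> K \<subseteq> U \<Longrightarrow> spherical_uniform_limit K h g"
  shows "continuous_on U (\<lambda>z. stereographic (g z))"
proof -
  have "continuous (at w) (\<lambda>z. stereographic (g z))" if "w \<in> U" for w
  proof -
    obtain e where e: "e > 0" "cball w e \<subseteq> U"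
      using U \<open>w \<in> U\<close> open_contains_cball by metis
    have "continuous_on (cball w e) (\<lambda>z. stereographic (g z))"
    proof (rule uniform_limit_theorem)
      show "uniform_limit (cball w e) (\<lambda>n z. stereographic (Some (h n z)))
              (\<lambda>z. stereographic (g z)) sequentially"
        using e by (intro spherical_uniform_limit_stereographic lim) auto
      show "\<forall>\<^sub>F n in sequentially. continuous_on (cball w e) (\<lambda>z. stereographic (Some (h n z)))"
        using h e by (intro always_eventually allI continuous_on_stereographic_Some
          holomorphic_on_imp_continuous_on) (meson holomorphic_on_subset)
    qed auto
    thus ?thesis
      using e(1) by (intro continuous_on_interior[of "cball w e"]) (simp_all add: interior_cball)
  qed
  thus ?thesis
    by (simp add: continuous_at_imp_continuous_on)
qed

text \<open>Near a point where the limit is infinite, Hurwitz' theorem applies to \<open>1 / h n\<close>.\<close>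

lemma spherical_limit_infinite_or_finite:
  assumes U: "open U" "connected U" and h: "\<And>n. h n holomorphic_on U"
    and lim: "\<And>K. compact K \<Longrightarrow> K \<subseteq> U \<Longrightarrow> spherical_uniform_limit K h g"
    and q: "q \<in> U" "g q \<noteq> None" and z: "z \<in> U"
  shows "g z \<noteq> None"
proof -
  define S where "S = (\<lambda>z. stereographic (g z))"
  have contS: "continuous_on U S"
    unfolding S_def using U(1) h lim by (rule spherical_limit_continuous_on)
  define A where "A = {z \<in> U. g z = None}"
  define B where "B = {z \<in> U. g z \<noteq> None}"
  have "open A"
    unfolding open_contains_ball
  proof
    fix w assume "w \<in> A"
    hence w: "w \<in> U" "g w = None" by (auto simp: A_def)
    \<comment> \<open>Keeping the limit above height 1/2 serves twice: nearby functions avoid 0,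
      whose height is -1, and the denominator \<open>1 + snd (S z)\<close> of the chart at infinity
      stays above 1.\<close>
    have "open (U \<inter> (\<lambda>z. snd (S z)) -` {1/2<..})"
      using U(1) contS by (intro continuous_open_preimage continuous_intros) auto
    moreover have "w \<in> U \<inter> (\<lambda>z. snd (S z)) -` {1/2<..}"
      using w by (simp add: S_def)
    ultimately obtain e where e: "e > 0" "cball w e \<subseteq> U \<inter> (\<lambda>z. snd (S z)) -` {1/2<..}"
      using open_contains_cball by metis
    have sndS: "snd (S z) > 1/2" if "z \<in> cball w e" for z
      using e that by auto
    have ul: "uniform_limit (cball w e) (\<lambda>n z. stereographic (Some (h n z))) S sequentially"
      unfolding S_def using e by (intro spherical_uniform_limit_stereographic lim) auto
    then have "\<forall>\<^sub>F n in sequentially. \<forall>z\<in>cball w e. dist (stereographic (Some (h n z))) (S z) < 1/2"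
      by (rule uniform_limitD) simp
    then obtain N where N: "\<And>n z. n \<ge> N \<Longrightarrow> z \<in> cball w e \<Longrightarrow>
        dist (stereographic (Some (h n z))) (S z) < 1/2"
      unfolding eventually_sequentially by blast
    have nz: "h n z \<noteq> 0" if "n \<ge> N" "z \<in> cball w e" for n z
    proof
      assume "h n z = 0"
      hence "dist (snd (stereographic (Some (h n z)))) (snd (S z)) > 1/2"
        using sndS[OF that(2)] by (simp add: dist_real_def)
      thus False
        using N[OF that] dist_snd_le[of "stereographic (Some (h n z))" "S z"] by linarith
    qed
    \<comment> \<open>\<open>F\<close> and \<open>G\<close> are the sequence and its limit in the
      chart at infinity, where infinity becomes 0. The shift by \<open>N\<close> drops the functions
      that may vanish on the disc.\<close>
    define F where "F = (\<lambda>n z. inverse (h (n + N) z))"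
    define G where "G = (\<lambda>z. cnj (fst (S z)) / of_real (1 + snd (S z)))"
    have "uniform_limit (cball w e) (\<lambda>n z. stereographic (Some (h (n + N) z))) S sequentially"
      by (rule filterlim_compose[OF ul filterlim_add_const_nat_at_top])
    hence ul1: "uniform_limit (cball w e) (\<lambda>n z. cnj (fst (stereographic (Some (h (n + N) z)))))
          (\<lambda>z. cnj (fst (S z))) sequentially"
      and ul2: "uniform_limit (cball w e) (\<lambda>n z. complex_of_real (1 + snd (stereographic (Some (h (n + N) z)))))
          (\<lambda>z. of_real (1 + snd (S z))) sequentially"
      by (auto intro!: uniform_limit_intros bounded_linear.uniform_limit[OF bounded_linear_fst]
           bounded_linear.uniform_limit[OF bounded_linear_snd]
           bounded_linear.uniform_limit[OF bounded_linear_cnj]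
           bounded_linear.uniform_limit[OF bounded_linear_of_real]
           simp del: of_real_add stereographic.simps)
    have ulF: "uniform_limit (cball w e) F G sequentially"
      unfolding F_def G_def stereographic_inverse[symmetric]
    proof (rule uniform_lim_divide[OF ul1 ul2, where b = 1])
      have "norm (fst (S z)) \<le> 1" for z
        using norm_fst_le[of "fst (S z)" "snd (S z)"] by (simp add: S_def norm_stereographic)
      thus "bounded ((\<lambda>z. cnj (fst (S z))) ` cball w e)"
        by (auto simp: bounded_iff)
      show "1 \<le> norm (complex_of_real (1 + snd (S z)))" if "z \<in> cball w e" for z
        using sndS[OF that] by (simp del: of_real_add)
    qed auto
    have holF: "F n holomorphic_on cball w e" for n
      unfolding F_def using e nz[of "n + N"]
      by (intro holomorphic_intros holomorphic_on_subset[OF h]) auto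
    have "\<forall>\<^sub>F n in sequentially. continuous_on (cball w e) (F n) \<and> F n holomorphic_on ball w e"
      using holF holomorphic_on_subset[OF holF ball_subset_cball]
      by (simp add: holomorphic_on_imp_continuous_on)
    then obtain holG: "G holomorphic_on ball w e"
      using holomorphic_uniform_limit[OF _ ulF sequentially_bot] by blast
    have Gw: "G w = 0"
      using w by (simp add: G_def S_def)
    \<comment> \<open>Every \<open>F n\<close> is zero-free on the disc, being the inverse of a
      nonzero number, whereas \<open>G\<close> vanishes at \<open>w\<close>. Hurwitz' theorem
      permits this only for constant \<open>G\<close>.\<close>
    have "G constant_on ball w e"
    proof (rule ccontr)
      assume nc: "\<not> G constant_on ball w e"
      have "G w \<noteq> 0"
      proof (rule Hurwitz_no_zeros[OF open_ball connected_ball _ holG _ nc])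
        show "F n holomorphic_on ball w e" for n
          using holF ball_subset_cball by (rule holomorphic_on_subset)
        show "uniform_limit K F G sequentially" if "K \<subseteq> ball w e" for K
          using ulF that ball_subset_cball
          by (meson order_trans uniform_limit_on_subset)
        show "F n z \<noteq> 0" if "z \<in> ball w e" for n z
          using nz[of "n + N" z] that by (auto simp: F_def)
      qed (use e in auto)
      thus False using Gw by simp
    qed
    hence G0: "G z = 0" if "z \<in> ball w e" for z
      using Gw that e by (metis centre_in_ball constant_on_def)
    have "ball w e \<subseteq> A"
    proof
      fix z assume z: "z \<in> ball w e"
      \<comment> \<open>A vanishing chart coordinate leaves only the two poles, and the height
        excludes the south pole.\<close>
      have "snd (S z) > 1/2" using sndS z by auto
      moreover from this have "fst (S z) = 0"
        using G0[OF z] unfolding G_def by (simp del: of_real_add)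
      moreover have "(cmod x)\<^sup>2 + 1 > 0" for x
        by (smt (verit) zero_le_power2)
      ultimately have "g z = None"
        by (cases "g z") (auto simp: S_def add_eq_0_iff2 split: if_splits)
      thus "z \<in> A" using z e by (auto simp: A_def)
    qed
    thus "\<exists>e>0. ball w e \<subseteq> A" using e by blast
  qed
  moreover have "open B"
  proof -
    have "B = U \<inter> (\<lambda>z. snd (S z)) -` (- {1})"
      by (auto simp: B_def S_def snd_stereographic_eq_1_iff)
    thus ?thesis
      using U(1) contS by (auto intro!: continuous_open_preimage continuous_intros)
  qed
  moreover have "A \<inter> B \<inter> U = {}" "U \<subseteq> A \<union> B" "B \<inter> U \<noteq> {}"
    using q by (auto simp: A_def B_def)
  ultimately have "A \<inter> U = {}"
    using connectedD[OF U(2)] by blast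
  thus ?thesis
    using z by (auto simp: A_def)
qed

text \<open>If no bound existed, there would be \<open>h k\<close> in the family exceeding
  \<open>k\<close> somewhere on \<open>K\<close>. A subsequence converges spherically; its limit is
  finite at \<open>q\<close>, hence on all of \<open>U\<close>. By compactness the limit stays away
  from infinity on \<open>K\<close>, which bounds the tail of the subsequence there.\<close>

lemma normal_family_bounded_on_compact:
  assumes norm: "normal_family_on U F" and U: "open U" "connected U"
    and q: "q \<in> U" "bounded ((\<lambda>h. h q) ` F)" and K: "compact K" "K \<subseteq> U"
  obtains B where "\<And>h z. h \<in> F \<Longrightarrow> z \<in> K \<Longrightarrow> cmod (h z) \<le> B"
proof (rule ccontr)
  assume "\<not> thesis"
  hence "\<forall>k::nat. \<exists>h z. h \<in> F \<and> z \<in> K \<and> cmod (h z) > real k"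
    using that by (meson not_le)
  then obtain h z where hz: "\<And>k::nat. h k \<in> F" "\<And>k. z k \<in> K" "\<And>k. cmod (h k (z k)) > real k"
    by metis
  hence "range h \<subseteq> F" by auto
  then obtain r g where r: "strict_mono (r :: nat \<Rightarrow> nat)"
    and lim: "\<And>K. compact K \<Longrightarrow> K \<subseteq> U \<Longrightarrow> spherical_uniform_limit K (h \<circ> r) g"
    using norm unfolding normal_family_on_def by metis
  have hol: "(h \<circ> r) n holomorphic_on U" for n
    using norm hz unfolding normal_family_on_def by auto
  define S where "S = (\<lambda>z. stereographic (g z))"
  have ul: "uniform_limit L (\<lambda>n z. stereographic (Some ((h \<circ> r) n z))) S sequentially"
    if "compact L" "L \<subseteq> U" for L
    unfolding S_def using that by (intro spherical_uniform_limit_stereographic lim)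
  have contS: "continuous_on U S"
    unfolding S_def using U(1) hol lim by (rule spherical_limit_continuous_on)
  obtain M where M: "\<And>h. h \<in> F \<Longrightarrow> cmod (h q) \<le> M"
    using q(2) by (auto simp: bounded_iff)
  \<comment> \<open>The bound \<open>M\<close> at \<open>q\<close> keeps the heights at
    \<open>q\<close> below a constant less than 1, and this passes to the limit.\<close>
  have "(\<lambda>n. stereographic (Some ((h \<circ> r) n q))) \<longlonglongrightarrow> S q"
    using ul[of "{q}"] q by (auto intro: tendsto_uniform_limitI)
  hence "(\<lambda>n. snd (stereographic (Some ((h \<circ> r) n q)))) \<longlonglongrightarrow> snd (S q)"
    by (rule tendsto_snd)
  moreover have "snd (stereographic (Some ((h \<circ> r) n q))) \<le> 1 - 2 / (M\<^sup>2 + 1)" for n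
  proof -
    have "(cmod ((h \<circ> r) n q))\<^sup>2 \<le> M\<^sup>2"
      using M[of "h (r n)"] hz by (auto intro!: power_mono)
    moreover have "(cmod ((h \<circ> r) n q))\<^sup>2 + 1 > 0"
      by (smt (verit) zero_le_power2)
    ultimately show ?thesis
      unfolding snd_stereographic_Some by (simp add: frac_le)
  qed
  ultimately have "snd (S q) \<le> 1 - 2 / (M\<^sup>2 + 1)"
    by (meson LIMSEQ_le_const2)
  moreover have "2 / (M\<^sup>2 + 1) > 0"
    by (smt (verit) zero_le_power2 divide_pos_pos)
  ultimately have "g q \<noteq> None"
    unfolding S_def snd_stereographic_eq_1_iff[symmetric] by linarith
  hence fin: "g z \<noteq> None" if "z \<in> U" for z
    using spherical_limit_infinite_or_finite[OF U hol lim q(1)] that by blast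
  have "K \<noteq> {}" using hz(2) by auto
  moreover have "continuous_on K (\<lambda>z. snd (S z))"
    using contS K by (intro continuous_intros) (rule continuous_on_subset)
  ultimately obtain m where m: "m \<in> K" "\<And>z. z \<in> K \<Longrightarrow> snd (S z) \<le> snd (S m)"
    using continuous_attains_sup[OF K(1)] by metis
  \<comment> \<open>\<open>d\<close> is the gap in height between the limit on \<open>K\<close> and
    infinity. Half of it is spent on the approximation error; the remaining \<open>d/2\<close> turns
    into the bound \<open>4/d\<close> on the squared modulus.\<close>
  define d where "d = 1 - snd (S m)"
  have "snd (S m) \<noteq> 1"
    using fin m K by (auto simp: S_def snd_stereographic_eq_1_iff)
  moreover have "\<bar>snd (S m)\<bar> \<le> 1"
    using norm_snd_le[of "snd (S m)" "fst (S m)"] by (simp add: S_def norm_stereographic)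
  ultimately have "d > 0" by (simp add: d_def)
  have "\<forall>\<^sub>F n in sequentially. \<forall>z\<in>K. dist (stereographic (Some ((h \<circ> r) n z))) (S z) < d/2"
    using ul[OF K] by (rule uniform_limitD) (use \<open>d > 0\<close> in simp)
  then obtain N where N: "\<And>n z. n \<ge> N \<Longrightarrow> z \<in> K \<Longrightarrow>
      dist (stereographic (Some ((h \<circ> r) n z))) (S z) < d/2"
    unfolding eventually_sequentially by blast
  have bd: "(cmod (h (r n) z))\<^sup>2 \<le> 4/d" if "n \<ge> N" "z \<in> K" for n z
  proof -
    have "snd (stereographic (Some (h (r n) z))) - snd (S z) < d/2"
      using N[OF that] dist_snd_le[of "stereographic (Some (h (r n) z))" "S z"]
      by (simp add: dist_real_def del: stereographic.simps)
    moreover have "snd (S z) \<le> 1 - d"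
      using m(2)[OF that(2)] by (simp add: d_def)
    ultimately have "snd (stereographic (Some (h (r n) z))) < 1 - d/2"
      by linarith
    hence *: "d/2 < 2 / ((cmod (h (r n) z))\<^sup>2 + 1)"
      unfolding snd_stereographic_Some by simp
    have "(cmod (h (r n) z))\<^sup>2 + 1 > 0"
      by (smt (verit) zero_le_power2)
    with * have "((cmod (h (r n) z))\<^sup>2 + 1) * d < 4"
      by (simp add: field_simps)
    thus ?thesis using \<open>d > 0\<close> by (simp add: field_simps)
  qed
  \<comment> \<open>With \<open>n > 4/d + 1\<close> also \<open>n * n \<ge> n > 4/d\<close>,
    contradicting \<open>bd\<close>. Since \<open>r n \<ge> n\<close>, the chosen values along the
    subsequence still exceed \<open>n\<close>.\<close>
  obtain n where n: "n \<ge> N" "real n > 4/d + 1"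
    by (meson reals_Archimedean2 max.bounded_iff max.cobounded1 less_le_trans of_nat_le_iff
        nle_le)
  have "real n < cmod (h (r n) (z (r n)))"
    using hz(3)[of "r n"] seq_suble[OF r, of n] by linarith
  hence "real n * real n \<le> (cmod (h (r n) (z (r n))))\<^sup>2"
    unfolding power2_eq_square by (intro mult_mono) auto
  moreover have "4 / d > 0" using \<open>d > 0\<close> by simp
  hence "real n * 1 \<le> real n * real n"
    using n(2) by (intro mult_left_mono) linarith+
  ultimately show False
    using bd[OF n(1) hz(2)[of "r n"]] n(2) by linarith
qed

section \<open>Growth of transcendental entire functions and their iterates\<close>

text \<open>As \<open>f\<close> is not affine, some Taylor coefficient at 0 of order at least 2 is
  nonzero. Cauchy's inequality for it forces at least quadratic growth.\<close>

lemma nonpolynomial_growth: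
  assumes "transcendental_entire f"
  obtains r0 where "r0 > 0" "\<And>r. r \<ge> r0 \<Longrightarrow> \<exists>z. cmod z \<le> r \<and> cmod (f z) > C * r"
proof -
  have hol: "f holomorphic_on UNIV" and nonpoly: "\<nexists>p. f = poly p"
    using assms by (auto simp: transcendental_entire_def)
  have "\<exists>n\<ge>2. (deriv ^^ n) f 0 \<noteq> 0"
  proof (rule ccontr)
    assume "\<not> ?thesis"
    hence 0: "(deriv ^^ n) f 0 = 0" if "n \<ge> 2" for n
      using that by blast
    have "f z = poly [:f 0, deriv f 0:] z" for z
    proof -
      have "((\<lambda>n. (deriv ^^ n) f 0 / fact n * (z - 0)^n) sums f z)"
        by (rule holomorphic_power_series[where r = "cmod z + 1"])
           (auto intro: holomorphic_on_subset[OF hol])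
      moreover have "((\<lambda>n. (deriv ^^ n) f 0 / fact n * (z - 0)^n) sums
          (\<Sum>n\<in>{0,1}. (deriv ^^ n) f 0 / fact n * (z - 0)^n))"
      proof (rule sums_finite)
        fix n :: nat assume "n \<notin> {0,1}"
        hence "n \<ge> 2" by auto
        thus "(deriv ^^ n) f 0 / fact n * (z - 0) ^ n = 0" by (simp add: 0)
      qed auto
      ultimately show ?thesis
        using sums_unique2 by fastforce
    qed
    thus False using nonpoly by blast
  qed
  then obtain n where n: "n \<ge> 2" "(deriv ^^ n) f 0 \<noteq> 0" by blast
  define c where "c = cmod ((deriv ^^ n) f 0) / fact n"
  have "c > 0" using n by (simp add: c_def)
  \<comment> \<open>The 1 ensures \<open>r ^ 2 \<le> r ^ n\<close>; the other term ensures
    \<open>c * r \<ge> \<bar>C\<bar> + 1 > C\<close>.\<close>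
  define r0 where "r0 = max 1 ((\<bar>C\<bar> + 1) / c)"
  show ?thesis
  proof
    show "r0 > 0" by (simp add: r0_def)
    fix r assume "r \<ge> r0"
    hence r: "r \<ge> 1" "(\<bar>C\<bar> + 1) / c \<le> r" by (auto simp: r0_def)
    show "\<exists>z. cmod z \<le> r \<and> cmod (f z) > C * r"
    proof (rule ccontr)
      assume "\<not> ?thesis"
      hence "cmod (f z) \<le> C * r" if "cmod z \<le> r" for z
        using that by (meson not_le)
      hence "cmod ((deriv ^^ n) f 0) \<le> fact n * (C * r) / r ^ n"
        using r by (intro Cauchy_inequality holomorphic_on_imp_continuous_on
            holomorphic_on_subset[OF hol]) auto
      hence "c * r ^ n \<le> C * r"
        using r by (simp add: c_def field_simps)
      moreover have "c * r ^ 2 \<le> c * r ^ n"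
        using r n \<open>c > 0\<close> by (intro mult_left_mono power_increasing) auto
      ultimately have "(c * r) * r \<le> C * r"
        by (simp add: power2_eq_square)
      hence "c * r \<le> C" using r by simp
      moreover have "\<bar>C\<bar> + 1 \<le> c * r" using r \<open>c > 0\<close> by (simp add: field_simps)
      ultimately show False by linarith
    qed
  qed
qed

text \<open>A function missing one point on each of two circles omits two values, so it obeys Schottky's bound.\<close>

lemma entire_image_contains_circle:
  obtains C where "C > 0"
    "\<And>f r \<rho>. f holomorphic_on UNIV \<Longrightarrow> r > 0 \<Longrightarrow> \<rho> > 0 \<Longrightarrow> cmod (f 0) \<le> \<rho> \<Longrightarrow>
       \<exists>z. cmod z \<le> r / 2 \<and> cmod (f z) > C * \<rho> \<Longrightarrow> \<exists>\<sigma>\<ge>\<rho>. sphere 0 \<sigma> \<subseteq> f ` cball 0 r"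
proof -
  \<comment> \<open>Schottky's bound for functions of modulus at most 2 at the centre, evaluated on
    the disc of radius 1/2.\<close>
  define C0 :: real where "C0 = exp (pi * exp (pi * (2 + 2 * 2 + 12 * (1/2) / (1 - 1/2))))"
  have "C0 > 0" by (simp add: C0_def)
  show ?thesis
  proof
    \<comment> \<open>The constant comes from the final estimate
      \<open>cmod (f z) \<le> cmod a + C0 * cmod (b - a)\<close>, where
      \<open>cmod a = \<rho>\<close> and \<open>cmod (b - a) \<le> 3 * \<rho>\<close>.\<close>
    show "1 + 3 * C0 > 0" using \<open>C0 > 0\<close> by simp
    fix f :: "complex \<Rightarrow> complex" and r \<rho> :: real
    assume hol: "f holomorphic_on UNIV" and r: "r > 0" and rho: "\<rho> > 0" and f0: "cmod (f 0) \<le> \<rho>"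
      and "\<exists>z. cmod z \<le> r / 2 \<and> cmod (f z) > (1 + 3 * C0) * \<rho>"
    then obtain z where z: "cmod z \<le> r / 2" "cmod (f z) > (1 + 3 * C0) * \<rho>" by blast
    show "\<exists>\<sigma>\<ge>\<rho>. sphere 0 \<sigma> \<subseteq> f ` cball 0 r"
    proof (rule ccontr)
      assume "\<not> ?thesis"
      hence no: "\<not> sphere 0 \<sigma> \<subseteq> f ` cball 0 r" if "\<sigma> \<ge> \<rho>" for \<sigma>
        using that by blast
      obtain a where a: "cmod a = \<rho>" "a \<notin> f ` cball 0 r"
        using no[of \<rho>] by (auto simp: subset_iff)
      \<comment> \<open>Radii \<open>\<rho>\<close> and \<open>2 * \<rho>\<close> keep the omitted
        values at a distance between \<open>\<rho>\<close> and \<open>3 * \<rho>\<close>.\<close>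
      obtain b where b: "cmod b = 2 * \<rho>" "b \<notin> f ` cball 0 r"
        using no[of "2 * \<rho>"] rho by (auto simp: subset_iff)
      have ba: "\<rho> \<le> cmod (b - a)" "cmod (b - a) \<le> 3 * \<rho>"
        using norm_triangle_ineq2[of b a] norm_triangle_ineq4[of b a] a b by auto
      hence nz: "b - a \<noteq> 0" using rho by auto
      \<comment> \<open>The normalisation carries the disc of radius \<open>r\<close> to the unit
        disc and the omitted values \<open>a\<close>, \<open>b\<close> to 0, 1.\<close>
      define \<phi> where "\<phi> = (\<lambda>w. (f (of_real r * w) - a) / (b - a))"
      have "cmod (\<phi> (z / of_real r)) \<le> C0"
        unfolding C0_def
      proof (rule Schottky[of \<phi>])
        show "\<phi> holomorphic_on cball 0 1"
        proof -
          have "f \<circ> (\<lambda>w. of_real r * w) holomorphic_on cball 0 1"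
            by (rule holomorphic_on_compose)
               (auto intro!: holomorphic_intros intro: holomorphic_on_subset[OF hol])
          thus ?thesis
            unfolding \<phi>_def o_def using nz by (intro holomorphic_intros)
        qed
        have "cmod (f 0 - a) \<le> 2 * \<rho>"
          using norm_triangle_ineq4[of "f 0" a] a f0 by linarith
        also have "\<dots> \<le> 2 * cmod (b - a)" using ba by simp
        finally show "cmod (\<phi> 0) \<le> 2"
          using nz by (simp add: \<phi>_def norm_divide divide_le_eq)
        show "\<not> (\<phi> w = 0 \<or> \<phi> w = 1)" if "w \<in> cball 0 1" for w
        proof -
          have "of_real r * w \<in> cball 0 r"
            using that r by (simp add: norm_mult)
          hence "f (of_real r * w) \<noteq> a" "f (of_real r * w) \<noteq> b"
            using a b by (metis image_eqI)+
          thus ?thesis using nz by (auto simp: \<phi>_def)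
        qed
        show "cmod (z / of_real r) \<le> 1/2"
          using z r by (simp add: norm_divide divide_le_eq)
      qed auto
      hence "cmod (f z - a) \<le> C0 * cmod (b - a)"
        using nz r by (simp add: \<phi>_def norm_divide divide_le_eq)
      also have "\<dots> \<le> C0 * (3 * \<rho>)"
        using ba \<open>C0 > 0\<close> by (intro mult_left_mono) auto
      finally have "cmod (f z) \<le> \<rho> + C0 * (3 * \<rho>)"
        using norm_triangle_ineq2[of "f z" a] a by linarith
      thus False using z by (simp add: algebra_simps)
    qed
  qed
qed

lemma holomorphic_on_funpow:
  assumes "f holomorphic_on UNIV"
  shows "(f ^^ n) holomorphic_on UNIV"
proof (induction n)
  case (Suc n)
  thus ?case
    using assms holomorphic_on_compose holomorphic_on_subset
    by (metis funpow.simps(2) subset_UNIV)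
qed (simp add: id_def)

text \<open>The image of a large disc contains a circle of at least twice its radius. By the maximum
  modulus principle the next iterate is already as large on that circle as on the disc it bounds, so
  each application of \<open>f\<close> gains a factor 2.\<close>

lemma transcendental_iterates_growth:
  assumes "transcendental_entire f"
  obtains r0 where "r0 > 0" "\<And>n. \<exists>z. cmod z \<le> r0 \<and> cmod ((f ^^ n) z) \<ge> 2 ^ n * r0"
proof -
  have hol: "f holomorphic_on UNIV"
    using assms by (auto simp: transcendental_entire_def)
  obtain C where "C > 0" and C: "\<And>f r \<rho>. f holomorphic_on UNIV \<Longrightarrow> r > 0 \<Longrightarrow> \<rho> > 0 \<Longrightarrow> cmod (f 0) \<le> \<rho> \<Longrightarrow>
       \<exists>z. cmod z \<le> r / 2 \<and> cmod (f z) > C * \<rho> \<Longrightarrow> \<exists>\<sigma>\<ge>\<rho>. sphere 0 \<sigma> \<subseteq> f ` cball 0 r"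
    using entire_image_contains_circle by metis
  \<comment> \<open>Slope \<open>4 * C\<close> at radius \<open>r / 2\<close> gives
    \<open>C * (2 * r)\<close>, matching the circle radius \<open>2 * r\<close> sought
    below.\<close>
  obtain s where s: "s > 0" "\<And>r. r \<ge> s \<Longrightarrow> \<exists>z. cmod z \<le> r \<and> cmod (f z) > (4 * C) * r"
    using nonpolynomial_growth[OF assms, of "4 * C"] by metis
  define r0 where "r0 = 2 * s + cmod (f 0)"
  have "r0 > 0" using s by (simp add: r0_def add_pos_nonneg)
  have circle: "\<exists>\<sigma>\<ge>2 * r. sphere 0 \<sigma> \<subseteq> f ` cball 0 r" if "r \<ge> r0" for r
  proof -
    have r: "r / 2 \<ge> s" "cmod (f 0) \<le> 2 * r" "r > 0"
      using that s unfolding r0_def by (smt (verit) norm_ge_zero field_sum_of_halves)+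
    thus ?thesis
      using s(2)[OF r(1)] by (intro C[OF hol]) (auto simp: mult.assoc)
  qed
  \<comment> \<open>All radii \<open>r \<ge> r0\<close> are treated at once, because the induction
    hypothesis is applied to the circle's radius \<open>\<sigma>\<close>, which is known only from
    below.\<close>
  have "\<exists>z. cmod z \<le> r \<and> cmod ((f ^^ n) z) \<ge> 2 ^ n * r" if "r \<ge> r0" for n r
    using that
  proof (induction n arbitrary: r)
    case 0
    thus ?case using \<open>r0 > 0\<close> by (intro exI[of _ "of_real r"]) auto
  next
    case (Suc n)
    obtain \<sigma> where \<sigma>: "\<sigma> \<ge> 2 * r" "sphere 0 \<sigma> \<subseteq> f ` cball 0 r"
      using circle Suc.prems by blast
    have "\<sigma> \<ge> r0" using \<sigma> Suc.prems \<open>r0 > 0\<close> by linarith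
    have "\<sigma> > 0" using \<open>\<sigma> \<ge> r0\<close> \<open>r0 > 0\<close> by linarith
    obtain w where w: "cmod w \<le> \<sigma>" "2 ^ n * \<sigma> \<le> cmod ((f ^^ n) w)"
      using Suc.IH[OF \<open>\<sigma> \<ge> r0\<close>] by blast
    have "\<exists>u\<in>sphere 0 \<sigma>. 2 ^ n * \<sigma> \<le> cmod ((f ^^ n) u)"
    proof -
      have "compact (sphere (0::complex) \<sigma>)" "sphere (0::complex) \<sigma> \<noteq> {}"
        using \<open>\<sigma> > 0\<close> by auto
      moreover have "continuous_on (sphere 0 \<sigma>) (\<lambda>u. cmod ((f ^^ n) u))"
        by (intro continuous_intros holomorphic_on_imp_continuous_on
            holomorphic_on_subset[OF holomorphic_on_funpow[OF hol]]) auto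
      ultimately obtain u where u: "u \<in> sphere 0 \<sigma>"
        "\<And>v. v \<in> sphere 0 \<sigma> \<Longrightarrow> cmod ((f ^^ n) v) \<le> cmod ((f ^^ n) u)"
        using continuous_attains_sup by metis
      have "cmod ((f ^^ n) w) \<le> cmod ((f ^^ n) u)"
      proof (rule maximum_modulus_frontier[of "f ^^ n" "cball 0 \<sigma>"])
        show "continuous_on (closure (cball 0 \<sigma>)) (f ^^ n)"
          by (intro holomorphic_on_imp_continuous_on
            holomorphic_on_subset[OF holomorphic_on_funpow[OF hol]]) auto
        show "cmod ((f ^^ n) v) \<le> cmod ((f ^^ n) u)" if "v \<in> frontier (cball 0 \<sigma>)" for v
          using that u by simp
      qed (use w in \<open>auto intro: holomorphic_on_subset[OF holomorphic_on_funpow[OF hol]]\<close>)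
      thus ?thesis using u(1) w(2) by (meson order_trans)
    qed
    then obtain z where z: "cmod z \<le> r" "2 ^ n * \<sigma> \<le> cmod ((f ^^ n) (f z))"
      using \<sigma>(2) by (auto simp: subset_iff image_iff)
    have "2 ^ Suc n * r \<le> 2 ^ n * \<sigma>"
      using \<sigma>(1) by simp
    hence "2 ^ Suc n * r \<le> cmod ((f ^^ Suc n) z)"
      using z(2) unfolding funpow_Suc_right o_def by linarith
    thus ?case using z by blast
  qed
  thus ?thesis
    using that[OF \<open>r0 > 0\<close>] by blast
qed

section \<open>Propagation of bounded orbits\<close>

lemma normal_family_on_subset:
  assumes "normal_family_on U F" "V \<subseteq> U"
  shows "normal_family_on V F"
  using assms unfolding normal_family_on_def
  by (meson holomorphic_on_subset order_trans)

text \<open>On a disc of normality, one bounded orbit makes all orbits bounded. The points with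
  bounded orbit thus form a clopen set containing \<open>p\<close>, which is the whole plane;
  normality then yields bounds that are uniform near each point.\<close>

lemma Julia_set_empty_imp_locally_bounded:
  assumes J: "Julia_set f = {}" and p: "bounded ((\<lambda>n. (f ^^ n) p) ` {1..})"
  shows "\<exists>e B. e > 0 \<and> (\<forall>n\<ge>1. \<forall>w\<in>ball z e. cmod ((f ^^ n) w) \<le> B)"
proof -
  define F where "F = {f ^^ n |n. n \<ge> 1}"
  have im: "(\<lambda>h. h w) ` F = (\<lambda>n. (f ^^ n) w) ` {1..}" for w
    by (auto simp: F_def)
  have ball: "\<exists>e>0. normal_family_on (ball w e) F" for w
  proof -
    have "w \<in> Fatou_set f" using J by (auto simp: Julia_set_def)
    then obtain U where U: "open U" "w \<in> U" "normal_family_on U F"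
      by (auto simp: Fatou_set_def F_def)
    then obtain e where "e > 0" "ball w e \<subseteq> U"
      using open_contains_ball by blast
    with U(3) show ?thesis using normal_family_on_subset by blast
  qed
  define A where "A = {w. bounded ((\<lambda>h. h w) ` F)}"
  have step: "v \<in> A" if "normal_family_on (ball w e) F" "u \<in> ball w e" "u \<in> A" "v \<in> ball w e" for u v w e
  proof -
    note uv = that
    obtain B where "\<And>h z. h \<in> F \<Longrightarrow> z \<in> {v} \<Longrightarrow> cmod (h z) \<le> B"
      using normal_family_bounded_on_compact[OF uv(1), of u "{v}"] uv(2-) unfolding A_def by auto
    thus ?thesis by (auto simp: A_def bounded_iff)
  qed
  have "open A"
    unfolding open_contains_ball
  proof
    fix w assume "w \<in> A"
    obtain e where e: "e > 0" "normal_family_on (ball w e) F"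
      using ball by blast
    hence "ball w e \<subseteq> A"
      using step \<open>w \<in> A\<close> by (meson centre_in_ball subsetI)
    thus "\<exists>e>0. ball w e \<subseteq> A" using e by blast
  qed
  moreover have "closed A"
    unfolding closed_limpt islimpt_approachable
  proof (intro allI impI)
    fix w assume w: "\<forall>e>0. \<exists>x'\<in>A. x' \<noteq> w \<and> dist x' w < e"
    obtain e where e: "e > 0" "normal_family_on (ball w e) F"
      using ball by blast
    obtain u where "u \<in> A" "dist u w < e" using w e by blast
    thus "w \<in> A"
      using step[OF e(2), of u w] e(1) by (simp add: dist_commute)
  qed
  moreover have "p \<in> A"
    using p by (simp add: A_def im)
  ultimately have "A = UNIV"
    using clopen[of A] by auto
  obtain e where e: "e > 0" "normal_family_on (ball z e) F"
    using ball by blast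
  \<comment> \<open>Halving the radius provides a compact disc inside the disc of normality.\<close>
  have "bounded ((\<lambda>h. h z) ` F)" "cball z (e/2) \<subseteq> ball z e"
    using \<open>A = UNIV\<close> e(1) by (auto simp: A_def)
  then obtain B where B: "\<And>h w. h \<in> F \<Longrightarrow> w \<in> cball z (e/2) \<Longrightarrow> cmod (h w) \<le> B"
    using normal_family_bounded_on_compact[OF e(2), of z "cball z (e/2)"] e(1)
    by (metis centre_in_ball compact_cball connected_ball open_ball)
  have "cmod ((f ^^ n) w) \<le> B" if "n \<ge> 1" "w \<in> ball z (e/2)" for n w
    using that by (intro B) (auto simp: F_def)
  thus ?thesis
    using e(1) by (intro exI[of _ "e/2"] exI[of _ B]) auto
qed

section \<open>A bounded orbit and the contradiction\<close>

text \<open>The second iterate is taken since \<open>f\<close> itself may have no fixed point, as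
  for \<open>exp z + z\<close>. By Picard's theorem, an entire \<open>f\<close> for which
  \<open>f \<circ> f\<close> has none is a translation.\<close>

lemma transcendental_entire_periodic_point:
  assumes "transcendental_entire f"
  obtains p where "f (f p) = p"
proof (rule holomorphic_involution_point)
  show "f holomorphic_on UNIV"
    using assms by (simp add: transcendental_entire_def)
  show "f \<noteq> (\<lambda>x. a + x)" for a
  proof
    assume "f = (\<lambda>x. a + x)"
    hence "f = poly [:a, 1:]" by auto
    thus False using assms by (auto simp: transcendental_entire_def)
  qed
qed

theorem mainTheorem1:
  fixes f :: "complex \<Rightarrow> complex"
  assumes "transcendental_entire f"
  shows "Julia_set f \<noteq> {}"
proof
  assume J: "Julia_set f = {}"
  obtain p where p: "f (f p) = p"
    using assms by (rule transcendental_entire_periodic_point)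
  have "(f ^^ n) p \<in> {p, f p}" for n
  proof (induction n)
    case (Suc n)
    thus ?case using p by (metis empty_iff funpow.simps(2) insert_iff o_apply)
  qed simp
  hence "(\<lambda>n. (f ^^ n) p) ` {1..} \<subseteq> {p, f p}"
    by blast
  hence "bounded ((\<lambda>n. (f ^^ n) p) ` {1..})"
    by (rule bounded_subset[rotated]) simp
  hence "\<forall>z. \<exists>e B. e > 0 \<and> (\<forall>n\<ge>1. \<forall>w\<in>ball z e. cmod ((f ^^ n) w) \<le> B)"
    by (intro allI Julia_set_empty_imp_locally_bounded[OF J])
  then obtain e B where e: "\<And>z. e z > 0"
    and B: "\<And>z n w. n \<ge> 1 \<Longrightarrow> w \<in> ball z (e z) \<Longrightarrow> cmod ((f ^^ n) w) \<le> B z"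
    by metis
  obtain r where r: "r > 0" "\<And>n. \<exists>z. cmod z \<le> r \<and> cmod ((f ^^ n) z) \<ge> 2 ^ n * r"
    using transcendental_iterates_growth[OF assms] by blast
  have "w \<in> (\<Union>z. ball z (e z))" for w
    using e[of w] by (intro UN_I[of w]) auto
  hence "cball 0 r \<subseteq> (\<Union>z. ball z (e z))" by blast
  then obtain T where T: "finite T" "cball 0 r \<subseteq> (\<Union>z\<in>T. ball z (e z))"
    using compactE_image[OF compact_cball, of UNIV "\<lambda>z. ball z (e z)" 0 r] open_ball by metis
  \<comment> \<open>Summing absolute values gives one number that dominates each of the finitely
    many local bounds.\<close>
  define M where "M = (\<Sum>z\<in>T. \<bar>B z\<bar>)"
  have M: "cmod ((f ^^ n) w) \<le> M" if "n \<ge> 1" "cmod w \<le> r" for n w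
  proof -
    have "w \<in> cball 0 r" using that by simp
    then obtain z where z: "z \<in> T" "w \<in> ball z (e z)" using T by blast
    have "cmod ((f ^^ n) w) \<le> \<bar>B z\<bar>"
      using B[OF that(1) z(2)] by simp
    also have "\<dots> \<le> M"
      unfolding M_def using T(1) z(1) by (intro member_le_sum) auto
    finally show ?thesis .
  qed
  obtain n where n: "M / r < 2 ^ n"
    using real_arch_pow[of 2 "M / r"] by auto
  have "M < 2 ^ n * r"
    using n r(1) by (simp add: divide_less_eq)
  \<comment> \<open>The exponent is raised to \<open>Suc n\<close> because the bound
    \<open>M\<close> covers iterates from the first on, and \<open>n\<close> may be 0.\<close>
  also have "\<dots> \<le> 2 ^ Suc n * r"
    using r(1) by simp
  finally have "M < 2 ^ Suc n * r" .
  moreover obtain z where "cmod z \<le> r" "2 ^ Suc n * r \<le> cmod ((f ^^ Suc n) z)"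
    using r(2) by blast
  ultimately show False
    using M[of "Suc n" z] by fastforce
qed

end
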